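(* Let $R$ be a commutative ring, $(D,>)$ a totally ordered set, $S$ a set with a binary operation $+$, and $h:D\times S\to R$. For $\mathbf{s}=(s_1,\dots,s_r)\in S^r$ set $H(\mathbf{s}):=\sum_{d_1>\cdots>d_r,\ d_i\in D}h(d_1,s_1)\cdots h(d_r,s_r)$. Let $n$ be odd, $s_1,\dots,s_n\in S$ pairwise distinct, $\mathbf{s}=(s_1,\dots,s_n)$, and $\mathbf{s}^j:=(s_i)_{i\ne j}$. Then $$\sum_{\sigma\in S_n}\operatorname{sgn}(\sigma)H(\sigma(\mathbf{s}))=\sum_{j=1}^n(-1)^{n-j}H(s_j)\Big(\sum_{\sigma\in S_n^j}\operatorname{sgn}(\sigma)H(\sigma(\mathbf{s}^j))\Big).$$
   Context: Such $H$ is called a sum of multiple harmonic type; infinite sums in $R$ are allowed formally, i.e. the sums are assumed to make sense and to be freely rearranged and multiplied term by term (automatic if $D$ is finite). $S_n$ is the symmetric group on $\{1,\dots,n\}$, $\sigma(\mathbf{s})=(s_{\sigma(1)},\dots,s_{\sigma(n)})$; $S_n^j$ is the symmetric group of $\{1,\dots,n\}\setminus\{j\}$ (sign as a permutation of that set), and for $\sigma\in S_n^j$, $\sigma(\mathbf{s}^j)=(s_{\sigma(1)},\dots,s_{\sigma(j-1)},s_{\sigma(j+1)},\dots,s_{\sigma(n)})$. *)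

theory Defs
  imports "HOL-Analysis.Analysis" "HOL-Combinatorics.Permutations"
begin

text \<open>
  Infinite sums in \<open>R\<close> are taken to be unconditional sums with respect to a Hausdorff ring topology.
  The topology is an explicit parameter rather than a type class, so that an arbitrary commutative
  ring with its discrete topology is covered; for finite \<open>D\<close> this gives ordinary finite sums
  (see the lemmas at the end).
\<close>

definition hausdorff_ring_topology :: "'r::comm_ring_1 topology \<Rightarrow> bool" where
  "hausdorff_ring_topology T \<longleftrightarrow>
     topspace T = UNIV \<and> Hausdorff_space T \<and>
     continuous_map (prod_topology T T) T (\<lambda>(x, y). x + y) \<and>
     continuous_map T T uminus \<and>
     continuous_map (prod_topology T T) T (\<lambda>(x, y). x * y)"

definition has_sum_in ::
    "'r::comm_monoid_add topology \<Rightarrow> ('i \<Rightarrow> 'r) \<Rightarrow> 'i set \<Rightarrow> 'r \<Rightarrow> bool" where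
  "has_sum_in T f A x \<longleftrightarrow> limitin T (sum f) x (finite_subsets_at_top A)"

definition infsum_in :: "'r::comm_monoid_add topology \<Rightarrow> ('i \<Rightarrow> 'r) \<Rightarrow> 'i set \<Rightarrow> 'r" where
  "infsum_in T f A = (THE x. has_sum_in T f A x)"

text \<open>
  Unconditional sums are invariant under reindexing; to split a sum freely into partial sums one also
  needs all subfamilies to be summable, which is automatic only in complete rings.
\<close>

definition freely_summable ::
    "'r::comm_monoid_add topology \<Rightarrow> ('i \<Rightarrow> 'r) \<Rightarrow> 'i set \<Rightarrow> bool" where
  "freely_summable T f A \<longleftrightarrow> (\<forall>B\<subseteq>A. \<exists>x. has_sum_in T f B x)"

definition termwise_multipliable ::
    "'r::comm_ring_1 topology \<Rightarrow> ('i \<Rightarrow> 'r) \<Rightarrow> 'i set \<Rightarrow> ('j \<Rightarrow> 'r) \<Rightarrow> 'j set \<Rightarrow> bool" where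
  "termwise_multipliable T f A g B \<longleftrightarrow>
     freely_summable T (\<lambda>(x, y). f x * g y) (A \<times> B) \<and>
     infsum_in T (\<lambda>(x, y). f x * g y) (A \<times> B) = infsum_in T f A * infsum_in T g B"

definition decreasing_tuples :: "'d::linorder set \<Rightarrow> nat \<Rightarrow> 'd list set" where
  "decreasing_tuples D r = {ds. length ds = r \<and> set ds \<subseteq> D \<and> sorted_wrt (>) ds}"

definition harmonic_term :: "('d \<Rightarrow> 's \<Rightarrow> 'r::comm_ring_1) \<Rightarrow> 's list \<Rightarrow> 'd list \<Rightarrow> 'r" where
  "harmonic_term h t ds = (\<Prod>i<length t. h (ds ! i) (t ! i))"

definition harmonic_sum ::
    "'r::comm_ring_1 topology \<Rightarrow> 'd::linorder set \<Rightarrow> ('d \<Rightarrow> 's \<Rightarrow> 'r) \<Rightarrow> 's list \<Rightarrow> 'r" where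
  "harmonic_sum T D h t = infsum_in T (harmonic_term h t) (decreasing_tuples D (length t))"

definition harmonic_summable ::
    "'r::comm_ring_1 topology \<Rightarrow> 'd::linorder set \<Rightarrow> ('d \<Rightarrow> 's \<Rightarrow> 'r) \<Rightarrow> 's list \<Rightarrow> bool" where
  "harmonic_summable T D h t \<longleftrightarrow>
     freely_summable T (harmonic_term h t) (decreasing_tuples D (length t))"

definition harmonic_multipliable ::
    "'r::comm_ring_1 topology \<Rightarrow> 'd::linorder set \<Rightarrow> ('d \<Rightarrow> 's \<Rightarrow> 'r) \<Rightarrow> 's list \<Rightarrow> 's list \<Rightarrow> bool" where
  "harmonic_multipliable T D h t u \<longleftrightarrow>
     termwise_multipliable T (harmonic_term h t) (decreasing_tuples D (length t))
                             (harmonic_term h u) (decreasing_tuples D (length u))"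

text \<open>
  Tuples \<open>(s\<^sub>1, \<dots>, s\<^sub>n)\<close> are functions on \<open>{1..n}\<close>. A permutation of \<open>{1..n} - {j}\<close> is, as usual
  in the library, a function on all of \<open>nat\<close> fixing everything outside that set, so its \<^const>\<open>sign\<close>
  is the one as a permutation of that set.
\<close>

definition perm_tuple :: "nat \<Rightarrow> (nat \<Rightarrow> 's) \<Rightarrow> (nat \<Rightarrow> nat) \<Rightarrow> 's list" where
  "perm_tuple n s \<sigma> = map (\<lambda>i. s (\<sigma> i)) [1..<Suc n]"

definition perm_tuple_omit :: "nat \<Rightarrow> (nat \<Rightarrow> 's) \<Rightarrow> nat \<Rightarrow> (nat \<Rightarrow> nat) \<Rightarrow> 's list" where
  "perm_tuple_omit n s j \<sigma> = map (\<lambda>i. s (\<sigma> i)) (filter (\<lambda>i. i \<noteq> j) [1..<Suc n])"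

lemma has_sum_in_euclidean: "has_sum_in euclidean f A x \<longleftrightarrow> (f has_sum x) A"
  by (simp add: has_sum_in_def has_sum_def)

lemma hausdorff_ring_topology_discrete: "hausdorff_ring_topology (discrete_topology UNIV)"
  by (simp add: hausdorff_ring_topology_def Hausdorff_space_discrete_topology
      flip: prod_topology_discrete_topology)

lemma has_sum_in_finite:
  assumes T: "hausdorff_ring_topology T" and A: "finite A"
  shows "has_sum_in T f A x \<longleftrightarrow> x = sum f A"
proof -
  have "finite_subsets_at_top A = principal {A}"
    using A by (simp add: finite_subsets_at_top_finite)
  then have *: "has_sum_in T f A x \<longleftrightarrow> (\<forall>U. openin T U \<and> x \<in> U \<longrightarrow> sum f A \<in> U)" for x
    using T by (simp add: has_sum_in_def limitin_def eventually_principal hausdorff_ring_topology_def)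
  show ?thesis
  proof
    assume L: "has_sum_in T f A x"
    show "x = sum f A"
    proof (rule ccontr)
      assume "x \<noteq> sum f A"
      then obtain U V where "openin T U" "openin T V" "x \<in> U" "sum f A \<in> V" "disjnt U V"
        using T unfolding hausdorff_ring_topology_def Hausdorff_space_def by blast
      with L show False by (auto simp: * disjnt_iff)
    qed
  qed (simp add: *)
qed

lemma infsum_in_finite:
  "hausdorff_ring_topology T \<Longrightarrow> finite A \<Longrightarrow> infsum_in T f A = sum f A"
  by (simp add: infsum_in_def has_sum_in_finite)

lemma finite_decreasing_tuples: "finite D \<Longrightarrow> finite (decreasing_tuples D r)"
  by (rule finite_subset[OF _ finite_lists_length_eq[of D r]]) (auto simp: decreasing_tuples_def)

lemma harmonic_sum_finite:
  "hausdorff_ring_topology T \<Longrightarrow> finite D \<Longrightarrow>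
     harmonic_sum T D h t = (\<Sum>ds\<in>decreasing_tuples D (length t). harmonic_term h t ds)"
  by (simp add: harmonic_sum_def infsum_in_finite finite_decreasing_tuples)

lemma freely_summable_finite:
  "hausdorff_ring_topology T \<Longrightarrow> finite A \<Longrightarrow> freely_summable T f A"
  by (meson freely_summable_def has_sum_in_finite finite_subset)

lemma harmonic_summable_finite:
  "hausdorff_ring_topology T \<Longrightarrow> finite D \<Longrightarrow> harmonic_summable T D h t"
  by (simp add: harmonic_summable_def freely_summable_finite finite_decreasing_tuples)

lemma harmonic_multipliable_finite:
  "hausdorff_ring_topology T \<Longrightarrow> finite D \<Longrightarrow> harmonic_multipliable T D h t u"
  by (simp add: harmonic_multipliable_def termwise_multipliable_def freely_summable_finite
      infsum_in_finite finite_decreasing_tuples sum_product sum.cartesian_product)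

end

theory Submission imports Defs begin

text \<open>
  The left-hand side is the sum over \<open>d\<^sub>1 > \<dots> > d\<^sub>n\<close> of the determinant \<open>W(d\<^sub>1, \<dots>, d\<^sub>n)\<close> of the
  matrix \<open>(h(d\<^sub>i, s\<^sub>j))\<close>. Since \<open>n\<close> is odd, \<open>(-1)\<^bsup>n-j\<^esup> = (-1)\<^bsup>j-1\<^esup>\<close>, so Laplace expansion along the first row
  turns the right-hand side into the sum of \<open>W(d, d\<^sub>2, \<dots>, d\<^sub>n)\<close> over all \<open>d\<close> and all
  \<open>d\<^sub>2 > \<dots> > d\<^sub>n\<close>. As \<open>W\<close> is alternating, the terms with \<open>d\<close> among the \<open>d\<^sub>i\<close> vanish, and moving
  \<open>d\<close> to its place \<open>k\<close> in the decreasing order costs the sign \<open>(-1)\<^bsup>k-1\<^esup>\<close>. Every decreasing \<open>n\<close>-tuple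
  thus arises once for each \<open>k = 1, \<dots>, n\<close>, and \<open>\<Sum>\<^sub>k (-1)\<^bsup>k-1\<^esup> = 1\<close> because \<open>n\<close> is odd.
\<close>

subsection \<open>Unconditional sums\<close>

lemma has_sum_in_unique:
  assumes "hausdorff_ring_topology T" "has_sum_in T f A x" "has_sum_in T f A y"
  shows "x = y"
  using limitin_Hausdorff_unique[of T "sum f" x "finite_subsets_at_top A" y] assms
  by (simp add: has_sum_in_def hausdorff_ring_topology_def)

lemma has_sum_in_infsum_in:
  assumes "hausdorff_ring_topology T" "has_sum_in T f A x"
  shows "has_sum_in T f A (infsum_in T f A)"
  unfolding infsum_in_def using assms has_sum_in_unique by (metis theI)

lemma has_sum_in_cong:
  assumes "\<And>a. a \<in> A \<Longrightarrow> f a = g a"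
  shows "has_sum_in T f A x \<longleftrightarrow> has_sum_in T g A x"
proof -
  have "eventually (\<lambda>F. sum f F = sum g F) (finite_subsets_at_top A)"
    using assms by (intro eventually_finite_subsets_at_top_weakI sum.cong) auto
  then show ?thesis
    unfolding has_sum_in_def
    by (metis (mono_tags, lifting) eventually_mono limitin_transform_eventually)
qed

lemma has_sum_in_add:
  assumes T: "hausdorff_ring_topology T"
    and f: "has_sum_in T f A x" and g: "has_sum_in T g A y"
  shows "has_sum_in T (\<lambda>a. f a + g a) A (x + y)"
proof -
  have "limitin (prod_topology T T) (\<lambda>F. (sum f F, sum g F)) (x, y) (finite_subsets_at_top A)"
    using f g by (simp add: has_sum_in_def limitin_pairwise o_def)
  moreover have "continuous_map (prod_topology T T) T (\<lambda>(x, y). x + y)"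
    using T by (simp add: hausdorff_ring_topology_def)
  moreover have "sum (\<lambda>a. f a + g a) = (\<lambda>F. sum f F + sum g F)"
    by (simp add: fun_eq_iff sum.distrib)
  ultimately show ?thesis
    by (auto dest: continuous_map_limit simp: has_sum_in_def o_def)
qed

lemma has_sum_in_cmult:
  assumes T: "hausdorff_ring_topology T" and f: "has_sum_in T f A x"
  shows "has_sum_in T (\<lambda>a. c * f a) A (c * x)"
proof -
  have "limitin (prod_topology T T) (\<lambda>F. (c, sum f F)) (c, x) (finite_subsets_at_top A)"
    using f T by (simp add: has_sum_in_def limitin_pairwise o_def hausdorff_ring_topology_def)
  moreover have "continuous_map (prod_topology T T) T (\<lambda>(x, y). x * y)"
    using T by (simp add: hausdorff_ring_topology_def)
  ultimately show ?thesis
    by (auto dest: continuous_map_limit simp: has_sum_in_def o_def sum_distrib_left)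
qed

text \<open>This moves the finite sums, over permutations and over positions \<open>k\<close>,
  inside an unconditional sum.\<close>

lemma has_sum_in_lincomb:
  assumes T: "hausdorff_ring_topology T" and "finite I"
    and "\<And>i. i \<in> I \<Longrightarrow> has_sum_in T (f i) A (x i)"
  shows "has_sum_in T (\<lambda>a. \<Sum>i\<in>I. c i * f i a) A (\<Sum>i\<in>I. c i * x i)"
  using assms(2,3)
proof (induction I rule: finite_induct)
  case empty
  show ?case
    using T by (simp add: has_sum_in_def hausdorff_ring_topology_def limitin_def)
next
  case (insert i I)
  then show ?case
    by (simp add: has_sum_in_add[OF T] has_sum_in_cmult[OF T])
qed

lemma has_sum_in_reindex:
  assumes "inj_on g A" "has_sum_in T (\<lambda>a. f (g a)) A x"
  shows "has_sum_in T f (g ` A) x"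
proof -
  have "eventually (\<lambda>F. sum (\<lambda>a. f (g a)) F = sum f (g ` F)) (finite_subsets_at_top A)"
    using assms(1) inj_on_subset
    by (intro eventually_finite_subsets_at_top_weakI) (fastforce simp: sum.reindex)
  then have "limitin T (\<lambda>F. sum f (g ` F)) x (finite_subsets_at_top A)"
    using assms(2) limitin_transform_eventually unfolding has_sum_in_def by fastforce
  then show ?thesis
    by (simp add: has_sum_in_def limitin_def eventually_filtermap
        flip: filtermap_image_finite_subsets_at_top[OF assms(1)])
qed

text \<open>Zero extension lets sums over different subsets be added as sums over one index set
  \<open>A\<close>. A finite \<open>F\<close> containing \<open>F0\<close> contributes only through
  \<open>F \<inter> B\<close>, which still contains \<open>F0\<close>.\<close>

lemma has_sum_in_extend:
  assumes "has_sum_in T f B x" "B \<subseteq> A"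
  shows "has_sum_in T (\<lambda>a. if a \<in> B then f a else 0) A x"
proof -
  have "eventually (\<lambda>F. (\<Sum>a\<in>F. if a \<in> B then f a else 0) \<in> U) (finite_subsets_at_top A)"
    if U: "eventually (\<lambda>F. sum f F \<in> U) (finite_subsets_at_top B)" for U
  proof -
    obtain F0 where F0: "finite F0" "F0 \<subseteq> B"
      "\<And>F. finite F \<Longrightarrow> F0 \<subseteq> F \<Longrightarrow> F \<subseteq> B \<Longrightarrow> sum f F \<in> U"
      using U unfolding eventually_finite_subsets_at_top by metis
    have "(\<Sum>a\<in>F. if a \<in> B then f a else 0) \<in> U" if "finite F" "F0 \<subseteq> F" "F \<subseteq> A" for F
      using F0(3)[of "F \<inter> B"] that F0(2) by (simp flip: sum.inter_restrict)
    then show ?thesis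
      unfolding eventually_finite_subsets_at_top using F0 assms(2) by (intro exI[of _ F0]) auto
  qed
  then show ?thesis
    using assms(1) by (simp add: has_sum_in_def limitin_def)
qed

subsection \<open>Alternating sums over permutations\<close>

text \<open>The determinant of the matrix \<open>a\<close>, by the Leibniz formula. Rows and columns
  are indexed by a set rather than a type, since the size \<open>n\<close> is a variable.\<close>

definition leibniz_sum :: "'i set \<Rightarrow> ('i \<Rightarrow> 'i \<Rightarrow> 'r::comm_ring_1) \<Rightarrow> 'r" where
  "leibniz_sum S a = (\<Sum>\<sigma> | \<sigma> permutes S. of_int (sign \<sigma>) * (\<Prod>i\<in>S. a i (\<sigma> i)))"

lemma leibniz_sum_cong:
  assumes "\<And>i j. i \<in> S \<Longrightarrow> j \<in> S \<Longrightarrow> a i j = b i j"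
  shows "leibniz_sum S a = leibniz_sum S b"
  unfolding leibniz_sum_def using assms
  by (intro sum.cong refl arg_cong2[where f = "(*)"] prod.cong) (auto simp: permutes_in_image)

lemma sign_comp_permutes:
  assumes "finite S" "p permutes S" "q permutes S"
  shows "sign (p \<circ> q) = sign p * sign q"
  using assms by (simp add: sign_compose permutes_imp_permutation)

text \<open>Replacing \<open>\<sigma>\<close> by \<open>\<sigma> \<circ> p\<close> in the sum and
  reindexing each product along \<open>p\<close> leaves only the factor
  \<open>sign p\<close>.\<close>

lemma leibniz_sum_permute_rows:
  assumes S: "finite S" and p: "p permutes S"
  shows "leibniz_sum S (\<lambda>i. a (p i)) = of_int (sign p) * leibniz_sum S a"
proof -
  have "leibniz_sum S (\<lambda>i. a (p i)) =
      (\<Sum>\<sigma> | \<sigma> permutes S. of_int (sign (\<sigma> \<circ> p)) * (\<Prod>i\<in>S. a (p i) (\<sigma> (p i))))"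
    unfolding leibniz_sum_def by (subst sum_permutations_compose_right[OF p]) simp
  also have "\<dots> = (\<Sum>\<sigma> | \<sigma> permutes S. of_int (sign p) * (of_int (sign \<sigma>) * (\<Prod>i\<in>S. a i (\<sigma> i))))"
  proof (rule sum.cong[OF refl])
    fix \<sigma> assume "\<sigma> \<in> {\<sigma>. \<sigma> permutes S}"
    then have "sign (\<sigma> \<circ> p) = sign \<sigma> * sign p"
      by (simp add: sign_comp_permutes[OF S _ p])
    moreover have "(\<Prod>i\<in>S. a (p i) (\<sigma> (p i))) = (\<Prod>i\<in>S. a i (\<sigma> i))"
      using prod.reindex_bij_betw[OF permutes_imp_bij[OF p], of "\<lambda>i. a i (\<sigma> i)"] by simp
    ultimately show "of_int (sign (\<sigma> \<circ> p)) * (\<Prod>i\<in>S. a (p i) (\<sigma> (p i))) =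
        of_int (sign p) * (of_int (sign \<sigma>) * (\<Prod>i\<in>S. a i (\<sigma> i)))"
      by (simp add: ac_simps)
  qed
  finally show ?thesis
    by (simp add: leibniz_sum_def sum_distrib_left)
qed

text \<open>Swapping the rows shows only that twice the determinant is 0, which is too weak when 2
  is a zero divisor. Instead \<open>\<sigma> \<mapsto> \<sigma> \<circ> t\<close> pairs the even
  permutations with the odd ones, and the terms of each pair cancel.\<close>

lemma leibniz_sum_equal_rows:
  assumes S: "finite S" and ij: "i \<in> S" "j \<in> S" "i \<noteq> j" and eq: "a i = a j"
  shows "leibniz_sum S a = 0"
proof -
  define t where "t = Transposition.transpose i j"
  have t: "t permutes S" and sign_t: "sign t = -1"
    using ij by (auto simp: t_def permutes_swap_id sign_swap_id)
  have a_t: "a (t k) = a k" for k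
    using eq by (simp add: t_def Transposition.transpose_def)
  define f where "f \<sigma> = of_int (sign \<sigma>) * (\<Prod>i\<in>S. a i (\<sigma> i))" for \<sigma>
  have f: "f (\<sigma> \<circ> t) = - f \<sigma>" and sign: "sign (\<sigma> \<circ> t) = - sign \<sigma>" if \<sigma>: "\<sigma> permutes S" for \<sigma>
  proof -
    show "sign (\<sigma> \<circ> t) = - sign \<sigma>"
      using sign_comp_permutes[OF S \<sigma> t] sign_t by simp
    moreover have "(\<Prod>i\<in>S. a i (\<sigma> (t i))) = (\<Prod>i\<in>S. a i (\<sigma> i))"
      using prod.reindex_bij_betw[OF permutes_imp_bij[OF t], of "\<lambda>i. a i (\<sigma> i)"] by (simp add: a_t)
    ultimately show "f (\<sigma> \<circ> t) = - f \<sigma>"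
      by (simp add: f_def)
  qed
  let ?E = "{\<sigma>. \<sigma> permutes S \<and> sign \<sigma> = 1}" and ?O = "{\<sigma>. \<sigma> permutes S \<and> sign \<sigma> \<noteq> 1}"
  have tt: "\<sigma> \<circ> t \<circ> t = \<sigma>" for \<sigma>
    by (simp add: t_def fun_eq_iff)
  have sign_cases: "sign \<sigma> = 1 \<or> sign \<sigma> = -1" for \<sigma> :: "'a \<Rightarrow> 'a"
    by (simp add: sign_def)
  have "sum f ?O = (\<Sum>\<sigma>\<in>?E. f (\<sigma> \<circ> t))"
    using sign_cases
    by (intro sum.reindex_bij_witness[where i = "\<lambda>\<sigma>. \<sigma> \<circ> t" and j = "\<lambda>\<sigma>. \<sigma> \<circ> t"])
      (auto simp: tt sign permutes_compose[OF t] simp del: o_apply dest: sign)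
  also have "\<dots> = - sum f ?E"
    by (simp add: f sum_negf)
  finally have "sum f ?E + sum f ?O = 0"
    by simp
  moreover have "sum f ?E + sum f ?O = sum f {\<sigma>. \<sigma> permutes S}"
    using finite_permutations[OF S] by (subst sum.union_disjoint[symmetric]) (auto intro: sum.cong)
  ultimately show ?thesis
    by (simp add: leibniz_sum_def f_def)
qed

text \<open>The cycle (1 2 ... k). It sends each position of a tuple to the position its entry has
  after the \<open>k\<close>-th entry is moved to the front.\<close>

definition front_cycle :: "nat \<Rightarrow> nat \<Rightarrow> nat" where
  "front_cycle k i = (if i = k then 1 else if 1 \<le> i \<and> i < k then Suc i else i)"

text \<open>Iterating this writes the cycle as a product of \<open>k - 1\<close> adjacent
  transpositions, which is how its sign is found.\<close>

lemma front_cycle_Suc: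
  "k \<ge> 1 \<Longrightarrow> front_cycle (Suc k) = front_cycle k \<circ> Transposition.transpose k (Suc k)"
  by (auto simp: front_cycle_def Transposition.transpose_def fun_eq_iff)

lemma front_cycle_permutes: "1 \<le> k \<Longrightarrow> front_cycle k permutes {1..k}"
proof (induction k rule: dec_induct)
  case base
  have "front_cycle 1 = id"
    by (auto simp: front_cycle_def fun_eq_iff)
  then show ?case by (metis permutes_id)
next
  case (step k)
  have "Transposition.transpose k (Suc k) permutes {1..Suc k}" "front_cycle k permutes {1..Suc k}"
    using step permutes_subset[of "front_cycle k" "{1..k}" "{1..Suc k}"]
    by (auto intro: permutes_swap_id)
  then show ?case
    using step(1) by (simp only: front_cycle_Suc permutes_compose)
qed

lemma sign_front_cycle: "1 \<le> k \<Longrightarrow> sign (front_cycle k) = (-1) ^ (k - 1)"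
proof (induction k rule: dec_induct)
  case base
  have "front_cycle 1 = id"
    by (auto simp: front_cycle_def fun_eq_iff)
  then show ?case by simp
next
  case (step k)
  have "permutation (front_cycle k)"
    using front_cycle_permutes[of k] step permutes_imp_permutation[of "{1..k}"] by simp
  then have "sign (front_cycle (Suc k)) = sign (front_cycle k) * sign (Transposition.transpose k (Suc k))"
    using step by (simp add: front_cycle_Suc sign_compose permutation_swap_id)
  then show ?case
    using step by (cases k) (auto simp: sign_swap_id)
qed

lemma front_cycle_permutes_superset:
  assumes "k \<in> {1..n}"
  shows "front_cycle k permutes {1..n}"
  using assms front_cycle_permutes[of k] permutes_subset[of _ "{1..k}" "{1..n}"] by auto

text \<open>Laplace expansion, obtained by grouping the permutations \<open>\<rho>\<close> by
  \<open>\<rho> 1 = j\<close>. On \<open>{1..n} - {j}\<close> the map \<open>front_cycle j\<close>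
  is the increasing bijection onto the rows \<open>{2..n}\<close>, so each minor becomes a sum over
  permutations of \<open>{1..n} - {j}\<close> alone.\<close>

lemma leibniz_sum_first_row:
  assumes "n \<ge> 1"
  shows "leibniz_sum {1..n} a =
    (\<Sum>j=1..n. (-1) ^ (j - 1) * a 1 j *
      (\<Sum>\<sigma> | \<sigma> permutes {1..n} - {j}.
         of_int (sign \<sigma>) * (\<Prod>i\<in>{1..n} - {j}. a (front_cycle j i) (\<sigma> i))))"
proof -
  let ?f = "\<lambda>\<rho>. of_int (sign \<rho>) * (\<Prod>i\<in>{1..n}. a i (\<rho> i))"
  have "(-1) ^ (j - 1) * a 1 j *
      (\<Sum>\<sigma> | \<sigma> permutes {1..n} - {j}.
         of_int (sign \<sigma>) * (\<Prod>i\<in>{1..n} - {j}. a (front_cycle j i) (\<sigma> i))) =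
      sum ?f {\<rho> \<in> {\<rho>. \<rho> permutes {1..n}}. \<rho> 1 = j}" if j: "j \<in> {1..n}" for j
  proof -
    let ?c = "front_cycle j"
    note c = front_cycle_permutes_superset[OF j]
    have cj: "?c j = 1" "inv ?c 1 = j"
      using permutes_inv_eq[OF c] by (auto simp: front_cycle_def)
    have fix_iff: "\<sigma> permutes {1..n} - {j} \<longleftrightarrow> \<sigma> permutes {1..n} \<and> \<sigma> j = j" for \<sigma>
      using permutes_subset[of \<sigma> "{1..n} - {j}" "{1..n}"] permutes_superset[of \<sigma> "{1..n}" "{1..n} - {j}"]
        permutes_not_in[of \<sigma> "{1..n} - {j}" j] by auto
    have "(-1) ^ (j - 1) * a 1 j *
      (\<Sum>\<sigma> | \<sigma> permutes {1..n} - {j}.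
         of_int (sign \<sigma>) * (\<Prod>i\<in>{1..n} - {j}. a (?c i) (\<sigma> i))) =
      (\<Sum>\<sigma> | \<sigma> permutes {1..n} - {j}.
         of_int (sign ?c * sign \<sigma>) * (\<Prod>i\<in>{1..n}. a (?c i) (\<sigma> i)))"
      unfolding sum_distrib_left
    proof (rule sum.cong[OF refl])
      fix \<sigma> assume "\<sigma> \<in> {\<sigma>. \<sigma> permutes {1..n} - {j}}"
      then have "\<sigma> j = j"
        using fix_iff by blast
      then have "(\<Prod>i\<in>{1..n}. a (?c i) (\<sigma> i)) = a 1 j * (\<Prod>i\<in>{1..n} - {j}. a (?c i) (\<sigma> i))"
        using prod.remove[of "{1..n}" j "\<lambda>i. a (?c i) (\<sigma> i)"] j cj by simp
      then show "(-1) ^ (j - 1) * a 1 j *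
            (of_int (sign \<sigma>) * (\<Prod>i\<in>{1..n} - {j}. a (?c i) (\<sigma> i))) =
          of_int (sign ?c * sign \<sigma>) * (\<Prod>i\<in>{1..n}. a (?c i) (\<sigma> i))"
        using j by (simp add: sign_front_cycle ac_simps)
    qed
    \<comment> \<open>The cycle sends \<open>j\<close> to 1, so \<open>\<sigma>\<close> fixes
      \<open>j\<close> exactly when \<open>\<rho> = \<sigma> \<circ> inv ?c\<close> sends 1 to
      \<open>j\<close>.\<close>
    also have "\<dots> = sum ?f {\<rho> \<in> {\<rho>. \<rho> permutes {1..n}}. \<rho> 1 = j}"
    proof (intro sum.reindex_bij_witness[where i = "\<lambda>\<rho>. \<rho> \<circ> ?c" and j = "\<lambda>\<sigma>. \<sigma> \<circ> inv ?c"])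
      fix \<sigma> assume \<sigma>: "\<sigma> \<in> {\<sigma>. \<sigma> permutes {1..n} - {j}}"
      then have \<sigma>': "\<sigma> permutes {1..n}" and \<sigma>j: "\<sigma> j = j"
        using fix_iff by blast+
      show "\<sigma> \<circ> inv ?c \<circ> ?c = \<sigma>"
        by (simp add: o_assoc[symmetric] permutes_inv_o[OF c])
      show "\<sigma> \<circ> inv ?c \<in> {\<rho> \<in> {\<rho>. \<rho> permutes {1..n}}. \<rho> 1 = j}"
        using cj \<sigma>j permutes_compose[OF permutes_inv[OF c] \<sigma>'] by simp
      have "sign (\<sigma> \<circ> inv ?c) = sign ?c * sign \<sigma>"
        using sign_comp_permutes[OF _ \<sigma>' permutes_inv[OF c]]
          sign_inverse[OF permutes_imp_permutation[OF _ c]] by simp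
      moreover have "(\<Prod>i\<in>{1..n}. a i (\<sigma> (inv ?c i))) = (\<Prod>i\<in>{1..n}. a (?c i) (\<sigma> i))"
        using prod.reindex_bij_betw[OF permutes_imp_bij[OF c], of "\<lambda>i. a i (\<sigma> (inv ?c i))"]
        by (simp add: permutes_inverses[OF c])
      ultimately show "of_int (sign (\<sigma> \<circ> inv ?c)) * (\<Prod>i\<in>{1..n}. a i ((\<sigma> \<circ> inv ?c) i)) =
          of_int (sign ?c * sign \<sigma>) * (\<Prod>i\<in>{1..n}. a (?c i) (\<sigma> i))"
        by simp
    next
      fix \<rho> assume \<rho>: "\<rho> \<in> {\<rho> \<in> {\<rho>. \<rho> permutes {1..n}}. \<rho> 1 = j}"
      show "\<rho> \<circ> ?c \<circ> inv ?c = \<rho>"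
        by (simp add: o_assoc[symmetric] permutes_inv_o[OF c])
      show "\<rho> \<circ> ?c \<in> {\<sigma>. \<sigma> permutes {1..n} - {j}}"
        using \<rho> cj permutes_compose[OF c, of \<rho>] fix_iff[of "\<rho> \<circ> ?c"] by simp
    qed
    finally show ?thesis .
  qed
  moreover have "(\<Sum>j=1..n. sum ?f {\<rho> \<in> {\<rho>. \<rho> permutes {1..n}}. \<rho> 1 = j}) = leibniz_sum {1..n} a"
    unfolding leibniz_sum_def
    using assms permutes_in_image[of _ "{1..n}" 1]
    by (intro sum.group) (auto simp: finite_permutations)
  ultimately show ?thesis by simp
qed

subsection \<open>Extracting an entry from a decreasing tuple\<close>

text \<open>The position \<open>k\<close> counts from \<open>1\<close>, to match permutations of \<open>{1..n}\<close>.\<close>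

definition extract_nth :: "nat \<Rightarrow> 'a list \<Rightarrow> 'a list \<times> 'a list" where
  "extract_nth k ds = ([ds ! (k - 1)], take (k - 1) ds @ drop k ds)"

lemma extract_nth_append:
  "extract_nth (Suc (length xs)) (xs @ d # ys) = ([d], xs @ ys)"
  by (simp add: extract_nth_def)

lemma split_at_index:
  assumes "k \<in> {1..length ds}"
  obtains xs d ys where "ds = xs @ d # ys" "k = Suc (length xs)"
  using assms id_take_nth_drop[of "k - 1" ds] that[of "take (k - 1) ds" "ds ! (k - 1)" "drop k ds"]
  by auto

text \<open>This identifies extraction with a permutation of matrix rows. The subtractions of 1
  convert positions counted from 1 to list indices counted from 0.\<close>

lemma nth_extract_nth:
  assumes "k \<in> {1..length ds}" "i \<in> {1..length ds}"
  shows "(fst (extract_nth k ds) @ snd (extract_nth k ds)) ! (front_cycle k i - 1) = ds ! (i - 1)"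
proof -
  obtain xs d ys where ds: "ds = xs @ d # ys" "k = Suc (length xs)"
    using split_at_index[OF assms(1)] .
  consider "i < k" | "i = k" | m where "i = Suc (k + m)"
    using less_imp_Suc_add by (metis linorder_neqE_nat)
  then show ?thesis
    using assms(2) unfolding ds extract_nth_append
    by cases (auto simp: front_cycle_def nth_append)
qed

text \<open>Keeping the extracted entry as a one-element list makes the target the index set of a
  product of two harmonic sums.\<close>

lemma extract_nth_in_tuples:
  assumes "k \<in> {1..n}" "ds \<in> decreasing_tuples D n"
  shows "extract_nth k ds \<in> decreasing_tuples D 1 \<times> decreasing_tuples D (n - 1)"
proof -
  have "length ds = n" using assms(2) by (simp add: decreasing_tuples_def)
  then obtain xs d ys where ds: "ds = xs @ d # ys" "k = Suc (length xs)"
    using split_at_index assms(1) by metis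
  show ?thesis
    using assms(2) unfolding ds extract_nth_append
    by (auto simp: decreasing_tuples_def sorted_wrt_append)
qed

lemma strictly_decreasing_unique:
  fixes xs ys :: "'d::linorder list"
  assumes "sorted_wrt (>) xs" "sorted_wrt (>) ys" "set xs = set ys"
  shows "xs = ys"
  using strict_sorted_equal[of "rev xs" "rev ys"] assms by (simp add: sorted_wrt_rev)

lemma strictly_decreasing_distinct:
  fixes xs :: "'d::linorder list"
  assumes "sorted_wrt (>) xs"
  shows "distinct xs"
  using assms strict_sorted_iff[of "rev xs"] by (simp add: sorted_wrt_rev)

text \<open>A decreasing tuple is determined by its set of entries, and its entries are distinct, so
  the extracted value also determines the position. Injectivity is joint in \<open>k\<close> and
  \<open>ds\<close>: the images for different \<open>k\<close> are disjoint.\<close>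

lemma extract_nth_inj:
  assumes "k \<in> {1..n}" "ds \<in> decreasing_tuples D n" "k' \<in> {1..n}" "ds' \<in> decreasing_tuples D n"
    and eq: "extract_nth k ds = extract_nth k' ds'"
  shows "k = k' \<and> ds = ds'"
proof -
  have len: "length ds = n" "length ds' = n" and sorted: "sorted_wrt (>) ds" "sorted_wrt (>) ds'"
    using assms by (auto simp: decreasing_tuples_def)
  obtain xs d ys where ds: "ds = xs @ d # ys" "k = Suc (length xs)"
    using split_at_index assms(1) len by metis
  obtain xs' d' ys' where ds': "ds' = xs' @ d' # ys'" "k' = Suc (length xs')"
    using split_at_index assms(3) len by metis
  have e: "d = d'" "xs @ ys = xs' @ ys'"
    using eq unfolding ds ds' extract_nth_append by auto
  then have "set ds = set ds'"
    unfolding ds ds' by (metis Un_insert_right list.simps(15) set_append)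
  then have *: "ds = ds'"
    using strictly_decreasing_unique sorted by blast
  moreover have "k - 1 = k' - 1"
    using strictly_decreasing_distinct[OF sorted(1)] assms(1,3) len * e(1)
      nth_eq_iff_index_eq[of ds "k - 1" "k' - 1"] ds ds' by (metis One_nat_def diff_Suc_1
        length_append_singleton nth_append_length Suc_le_eq atLeastAtMost_iff)
  ultimately show ?thesis using ds ds' by simp
qed

lemma strictly_decreasing_insert:
  fixes d :: "'d::linorder"
  assumes "sorted_wrt (>) xs" "d \<notin> set xs"
  obtains ys zs where "xs = ys @ zs" "sorted_wrt (>) (ys @ d # zs)"
  using assms
proof (induction xs arbitrary: thesis)
  case Nil
  show ?case using Nil(1)[of "[]" "[]"] by simp
next
  case (Cons x xs)
  show ?case
  proof (cases "x < d")
    case True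
    then show ?thesis
      using Cons.prems(2) by (intro Cons.prems(1)[of "[]" "x # xs"]) auto
  next
    case False
    then have "d < x" using Cons.prems(3) by auto
    obtain ys zs where "xs = ys @ zs" "sorted_wrt (>) (ys @ d # zs)"
      using Cons.IH Cons.prems by auto
    then show ?thesis
      using \<open>d < x\<close> Cons.prems(2) by (intro Cons.prems(1)[of "x # ys" zs]) auto
  qed
qed

text \<open>Together with injectivity, this shows that the pairs with \<open>d\<close> not in
  \<open>ds\<close> correspond bijectively to decreasing \<open>n\<close>-tuples with a marked
  position.\<close>

lemma extract_nth_surj:
  assumes "[d] \<in> decreasing_tuples D 1" "ds \<in> decreasing_tuples D (n - 1)" "n \<ge> 1" "d \<notin> set ds"
  obtains k es where "k \<in> {1..n}" "es \<in> decreasing_tuples D n" "extract_nth k es = ([d], ds)"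
proof -
  obtain ys zs where "ds = ys @ zs" "sorted_wrt (>) (ys @ d # zs)"
    using strictly_decreasing_insert[of ds d] assms by (auto simp: decreasing_tuples_def)
  then show ?thesis
    using assms that[of "Suc (length ys)" "ys @ d # zs"]
    by (auto simp: decreasing_tuples_def extract_nth_append)
qed

subsection \<open>Harmonic terms\<close>

lemma harmonic_term_perm_tuple:
  "harmonic_term h (perm_tuple n s \<sigma>) ds = (\<Prod>i=1..n. h (ds ! (i - 1)) (s (\<sigma> i)))"
  unfolding harmonic_term_def perm_tuple_def
  by (rule prod.reindex_bij_witness[where i = "\<lambda>i. i - 1" and j = Suc]) (auto simp del: upt_Suc)

text \<open>The head \<open>d\<close> is arbitrary: for \<open>i \<noteq> j\<close> the value
  \<open>front_cycle j i\<close> is at least 2, so the head is never read. Having it there gives the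
  product the form it has in the first-row expansion.\<close>

lemma harmonic_term_perm_tuple_omit:
  assumes "j \<in> {1..n}"
  shows "harmonic_term h (perm_tuple_omit n s j \<sigma>) ds =
    (\<Prod>i\<in>{1..n} - {j}. h ((d # ds) ! (front_cycle j i - 1)) (s (\<sigma> i)))"
proof -
  have "[1..<Suc n] = [1..<j] @ j # [Suc j..<Suc n]"
    using assms upt_add_eq_append[of 1 j "Suc n - j"] by (simp add: upt_conv_Cons del: upt_Suc)
  then have f: "filter (\<lambda>i. i \<noteq> j) [1..<Suc n] = [1..<j] @ [Suc j..<Suc n]"
    by (simp add: filter_id_conv del: upt_Suc)
  show ?thesis
    unfolding harmonic_term_def perm_tuple_omit_def f
    using assms
    \<comment> \<open>Position \<open>i\<close> has list index \<open>i - 1\<close> before the gap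
      at \<open>j\<close> and \<open>i - 2\<close> after it.\<close>
    by (intro prod.reindex_bij_witness[where i = "\<lambda>i. if i < j then i - 1 else i - 2"
          and j = "\<lambda>i. if Suc i < j then Suc i else Suc (Suc i)"])
      (auto simp: nth_append front_cycle_def nth_Cons split: nat.splits simp del: upt_Suc)
qed

lemma length_perm_tuple [simp]: "length (perm_tuple n s \<sigma>) = n"
  by (simp add: perm_tuple_def)

lemma length_perm_tuple_omit:
  assumes "j \<in> {1..n}"
  shows "length (perm_tuple_omit n s j \<sigma>) = n - 1"
proof -
  have "length (perm_tuple_omit n s j \<sigma>) = card (set (filter (\<lambda>i. i \<noteq> j) [1..<Suc n]))"
    unfolding perm_tuple_omit_def by (simp only: length_map distinct_card distinct_filter distinct_upt)
  also have "set (filter (\<lambda>i. i \<noteq> j) [1..<Suc n]) = {1..n} - {j}"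
    by auto
  finally show ?thesis using assms by simp
qed

text \<open>The determinant \<open>W\<close> of the overview. It is defined on all lists, not only
  decreasing ones, so that entries may be moved out of order.\<close>

definition alternating_term ::
    "nat \<Rightarrow> (nat \<Rightarrow> 's) \<Rightarrow> ('d \<Rightarrow> 's \<Rightarrow> 'r::comm_ring_1) \<Rightarrow> 'd list \<Rightarrow> 'r" where
  "alternating_term n s h ds = leibniz_sum {1..n} (\<lambda>i j. h (ds ! (i - 1)) (s j))"

lemma alternating_term_eq:
  "alternating_term n s h ds =
    (\<Sum>\<sigma> | \<sigma> permutes {1..n}. of_int (sign \<sigma>) * harmonic_term h (perm_tuple n s \<sigma>) ds)"
  by (simp add: alternating_term_def leibniz_sum_def harmonic_term_perm_tuple)

lemma alternating_term_Cons:
  assumes "n \<ge> 1"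
  shows "alternating_term n s h (d # ds) =
    (\<Sum>j=1..n. (-1) ^ (j - 1) * (\<Sum>\<sigma> | \<sigma> permutes {1..n} - {j}.
       of_int (sign \<sigma>) * (harmonic_term h [s j] [d] * harmonic_term h (perm_tuple_omit n s j \<sigma>) ds)))"
proof -
  have "harmonic_term h [s j] [d] = h d (s j)" for j
    by (simp add: harmonic_term_def)
  then show ?thesis
    unfolding alternating_term_def leibniz_sum_first_row[OF assms]
    by (intro sum.cong refl)
      (simp only: harmonic_term_perm_tuple_omit[where d = d], simp add: sum_distrib_left ac_simps)
qed

lemma alternating_term_repeated:
  assumes "length ds = n - 1" "d \<in> set ds"
  shows "alternating_term n s h (d # ds) = 0"
proof -
  obtain k where k: "k < length ds" "ds ! k = d"
    using assms(2) by (auto simp: in_set_conv_nth)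
  then show ?thesis
    unfolding alternating_term_def using assms(1)
    \<comment> \<open>Row 1 is \<open>d\<close>, and \<open>ds ! k\<close> sits in row
      \<open>k + 2\<close>: one shift for the prepended head, one for counting rows from 1.\<close>
    by (intro leibniz_sum_equal_rows[of _ 1 "Suc (Suc k)"]) auto
qed

lemma alternating_term_extract_nth:
  assumes "k \<in> {1..n}" "length ds = n"
  shows "alternating_term n s h (fst (extract_nth k ds) @ snd (extract_nth k ds)) =
    (-1) ^ (k - 1) * alternating_term n s h ds"
proof -
  let ?es = "fst (extract_nth k ds) @ snd (extract_nth k ds)"
  have "alternating_term n s h ds =
      leibniz_sum {1..n} (\<lambda>i j. h (?es ! (front_cycle k i - 1)) (s j))"
    unfolding alternating_term_def using assms
    by (intro leibniz_sum_cong) (simp only: nth_extract_nth)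
  also have "\<dots> = (-1) ^ (k - 1) * alternating_term n s h ?es"
    unfolding alternating_term_def
    using assms leibniz_sum_permute_rows[OF _ front_cycle_permutes_superset[OF assms(1)],
        of "\<lambda>i j. h (?es ! (i - 1)) (s j)"]
    by (simp add: sign_front_cycle)
  \<comment> \<open>The sign stands on the other side of the equation here; it moves across because
    its square is 1.\<close>
  finally show ?thesis
    by (simp add: mult.assoc[symmetric] power_add[symmetric] flip: mult_2)
qed

text \<open>This is the total weight with which each decreasing tuple is counted once all positions
  \<open>k\<close> are taken together.\<close>

lemma sum_alternating_signs:
  "(\<Sum>k=1..n. (-1) ^ (k - 1)) = (if odd n then 1 else 0 :: 'r::comm_ring_1)"
  by (induction n) auto

section \<open>Evaluating one sum over pairs in two ways\<close>

theorem theorem4p2: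
  fixes T :: "'r::comm_ring_1 topology"
    and D :: "'d::linorder set"
    and h :: "'d \<Rightarrow> 's::plus \<Rightarrow> 'r"
    and s :: "nat \<Rightarrow> 's"
    and n :: nat
  assumes "hausdorff_ring_topology T"
    and "odd n"
    and "inj_on s {1..n}"
    and "\<And>\<sigma>. \<sigma> permutes {1..n} \<Longrightarrow> harmonic_summable T D h (perm_tuple n s \<sigma>)"
    and "\<And>j. j \<in> {1..n} \<Longrightarrow> harmonic_summable T D h [s j]"
    and "\<And>j \<sigma>. j \<in> {1..n} \<Longrightarrow> \<sigma> permutes {1..n} - {j} \<Longrightarrow>
           harmonic_summable T D h (perm_tuple_omit n s j \<sigma>)"
    and "\<And>j \<sigma>. j \<in> {1..n} \<Longrightarrow> \<sigma> permutes {1..n} - {j} \<Longrightarrow>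
           harmonic_multipliable T D h [s j] (perm_tuple_omit n s j \<sigma>)"
  shows "(\<Sum>\<sigma> | \<sigma> permutes {1..n}. of_int (sign \<sigma>) * harmonic_sum T D h (perm_tuple n s \<sigma>)) =
         (\<Sum>j = 1..n. (-1) ^ (n - j) * harmonic_sum T D h [s j] *
            (\<Sum>\<sigma> | \<sigma> permutes {1..n} - {j}.
               of_int (sign \<sigma>) * harmonic_sum T D h (perm_tuple_omit n s j \<sigma>)))"
  (is "?L = ?R")
proof -
  note T = assms(1)
  have n: "n \<ge> 1" using assms(2) by (cases n) auto
  let ?W = "alternating_term n s h"
  let ?P = "decreasing_tuples D 1 \<times> decreasing_tuples D (n - 1)"
  let ?w = "\<lambda>p. ?W (fst p @ snd p)"
  let ?X = "\<lambda>k. extract_nth k ` decreasing_tuples D n"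
  have L: "has_sum_in T ?W (decreasing_tuples D n) ?L"
    unfolding alternating_term_eq
  proof (intro has_sum_in_lincomb[OF T])
    fix \<sigma> assume "\<sigma> \<in> {\<sigma>. \<sigma> permutes {1..n}}"
    then have "freely_summable T (harmonic_term h (perm_tuple n s \<sigma>)) (decreasing_tuples D n)"
      using assms(4) by (auto simp: harmonic_summable_def)
    then show "has_sum_in T (harmonic_term h (perm_tuple n s \<sigma>)) (decreasing_tuples D n)
        (harmonic_sum T D h (perm_tuple n s \<sigma>))"
      using has_sum_in_infsum_in[OF T] by (auto simp: freely_summable_def harmonic_sum_def)
  qed (simp add: finite_permutations)
  have single: "\<exists>d. x = [d]" if "x \<in> decreasing_tuples D 1" for x
    using that by (auto simp: decreasing_tuples_def length_Suc_conv)
  have R: "has_sum_in T ?w ?P ?R"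
  proof -
    let ?t = "\<lambda>j \<sigma> p. harmonic_term h [s j] (fst p) * harmonic_term h (perm_tuple_omit n s j \<sigma>) (snd p)"
    have "has_sum_in T (?t j \<sigma>) ?P
        (harmonic_sum T D h [s j] * harmonic_sum T D h (perm_tuple_omit n s j \<sigma>))"
      \<comment> \<open>Term-by-term multiplication turns the product of the two harmonic sums into
        a single sum over \<open>?P\<close>.\<close>
      if "j \<in> {1..n}" "\<sigma> permutes {1..n} - {j}" for j \<sigma>
    proof -
      have "termwise_multipliable T (harmonic_term h [s j]) (decreasing_tuples D 1)
          (harmonic_term h (perm_tuple_omit n s j \<sigma>)) (decreasing_tuples D (n - 1))"
        using assms(7)[OF that] that by (simp add: harmonic_multipliable_def length_perm_tuple_omit)
      then show ?thesis
        using has_sum_in_infsum_in[OF T, of "?t j \<sigma>" ?P] that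
        by (auto simp: termwise_multipliable_def freely_summable_def harmonic_sum_def
            length_perm_tuple_omit case_prod_unfold)
    qed
    then have "has_sum_in T (\<lambda>p. \<Sum>j=1..n. (-1) ^ (j - 1) *
          (\<Sum>\<sigma> | \<sigma> permutes {1..n} - {j}. of_int (sign \<sigma>) * ?t j \<sigma> p)) ?P
        (\<Sum>j=1..n. (-1) ^ (j - 1) * (\<Sum>\<sigma> | \<sigma> permutes {1..n} - {j}. of_int (sign \<sigma>) *
           (harmonic_sum T D h [s j] * harmonic_sum T D h (perm_tuple_omit n s j \<sigma>))))"
      by (intro has_sum_in_lincomb[OF T]) (auto simp: finite_permutations)
    moreover have "(\<Sum>j=1..n. (-1) ^ (j - 1) * (\<Sum>\<sigma> | \<sigma> permutes {1..n} - {j}. of_int (sign \<sigma>) *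
           (harmonic_sum T D h [s j] * harmonic_sum T D h (perm_tuple_omit n s j \<sigma>)))) = ?R"
    proof (rule sum.cong[OF refl])
      fix j assume "j \<in> {1..n}"
      \<comment> \<open>The exponents \<open>j - 1\<close> and \<open>n - j\<close> add up to the
        even number \<open>n - 1\<close>, so they have the same parity.\<close>
      then have "(-1) ^ (j - 1) = ((-1) ^ (n - j) :: 'r)"
        using assms(2) by (auto simp: minus_one_power_iff even_diff_nat)
      then show "(-1) ^ (j - 1) * (\<Sum>\<sigma> | \<sigma> permutes {1..n} - {j}. of_int (sign \<sigma>) *
           (harmonic_sum T D h [s j] * harmonic_sum T D h (perm_tuple_omit n s j \<sigma>))) =
         (-1) ^ (n - j) * harmonic_sum T D h [s j] *
            (\<Sum>\<sigma> | \<sigma> permutes {1..n} - {j}.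
               of_int (sign \<sigma>) * harmonic_sum T D h (perm_tuple_omit n s j \<sigma>))"
        by (simp add: sum_distrib_left ac_simps)
    qed
    moreover have "?w p = (\<Sum>j=1..n. (-1) ^ (j - 1) *
          (\<Sum>\<sigma> | \<sigma> permutes {1..n} - {j}. of_int (sign \<sigma>) * ?t j \<sigma> p))" if p: "p \<in> ?P" for p
    proof -
      obtain d where "fst p = [d]" using p single[of "fst p"] by (auto simp del: One_nat_def)
      then show ?thesis by (simp add: alternating_term_Cons[OF n])
    qed
    ultimately show ?thesis
      using has_sum_in_cong[of ?P ?w] by simp
  qed
  have inj: "inj_on (extract_nth k) (decreasing_tuples D n)" if "k \<in> {1..n}" for k
    using extract_nth_inj that by (intro inj_onI) blast
  \<comment> \<open>The pairs arising from position \<open>k\<close> carry the left-hand sum up to a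
    sign: \<open>L\<close> is scaled, transported along \<open>extract_nth k\<close>, and extended
    by zero to \<open>?P\<close>.\<close>
  have "has_sum_in T (\<lambda>p. if p \<in> ?X k then ?w p else 0) ?P ((-1) ^ (k - 1) * ?L)"
    if k: "k \<in> {1..n}" for k
  proof -
    have "has_sum_in T (\<lambda>ds. ?w (extract_nth k ds)) (decreasing_tuples D n) ((-1) ^ (k - 1) * ?L)"
      by (intro iffD2[OF has_sum_in_cong has_sum_in_cmult[OF T L]] alternating_term_extract_nth[OF k])
        (simp add: decreasing_tuples_def)
    then show ?thesis
      by (intro has_sum_in_extend has_sum_in_reindex inj k image_subsetI extract_nth_in_tuples)
  qed
  \<comment> \<open>The factors 1 put the sum in the shape of a linear combination with all
    coefficients equal to 1.\<close>
  then have sum_parts: "has_sum_in T (\<lambda>p. \<Sum>k=1..n. 1 * (if p \<in> ?X k then ?w p else 0)) ?P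
      (\<Sum>k=1..n. 1 * ((-1) ^ (k - 1) * ?L))"
    by (intro has_sum_in_lincomb[OF T]) auto
  \<comment> \<open>The images \<open>?X k\<close> account for every nonzero term exactly once: if
    \<open>d\<close> repeats an entry of \<open>ds\<close> the determinant vanishes, and otherwise
    \<open>p\<close> lies in exactly one image.\<close>
  have parts: "(\<Sum>k=1..n. 1 * (if p \<in> ?X k then ?w p else 0)) = ?w p" if p: "p \<in> ?P" for p
  proof -
    obtain d ds where p_eq: "p = ([d], ds)" using p single[of "fst p"] by (cases p) (auto simp del: One_nat_def)
    show ?thesis
    proof (cases "d \<in> set ds")
      case True
      then have "?w p = 0"
        using p alternating_term_repeated[of ds n d] by (simp add: p_eq decreasing_tuples_def)
      then show ?thesis by (simp cong: if_cong)
    next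
      case False
      then obtain k es where k: "k \<in> {1..n}" "es \<in> decreasing_tuples D n" "extract_nth k es = p"
        using extract_nth_surj[of d D ds n] p n by (auto simp: p_eq simp del: One_nat_def)
      then have "p \<in> ?X k' \<longleftrightarrow> k' = k" if "k' \<in> {1..n}" for k'
        using extract_nth_inj that by blast
      then have "(\<Sum>k'=1..n. 1 * (if p \<in> ?X k' then ?w p else 0)) =
          (\<Sum>k'=1..n. if k' = k then ?w p else 0)"
        by (intro sum.cong) auto
      then show ?thesis using k by simp
    qed
  qed
  have "has_sum_in T ?w ?P (\<Sum>k=1..n. 1 * ((-1) ^ (k - 1) * ?L))"
    by (rule iffD1[OF has_sum_in_cong[OF parts] sum_parts])
  moreover have "(\<Sum>k=1..n. 1 * ((-1) ^ (k - 1) * ?L)) = ?L"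
    using assms(2) by (simp only: mult_1 sum_alternating_signs if_True not_False_eq_True flip: sum_distrib_right)
  \<comment> \<open>Both sides are now values of the same unconditional sum over \<open>?P\<close>,
    and such a value is unique in a Hausdorff space.\<close>
  ultimately show ?thesis
    using has_sum_in_unique[OF T _ R] by simp
qed

end
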